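(* Let $A_1,\dots,A_n$ be $\forall$-negative types, $A$ a $\forall$-positive type of $AF2$ which does not end with $\perp$, $B_1,\dots,B_m$ classical types, and $t$ a $\beta$-normal $\lambda C$-term. If $x_1:A_1,\dots,x_n:A_n,y_1:B_1,\dots,y_m:B_m\vdash_{M2}t:A$, then $t$ is a normal $\lambda$-term (it does not contain $C$) and $x_1:A_1,\dots,x_n:A_n\vdash_{AF2}t:A$.
   Context: $\lambda C$-terms are terms of the pure $\lambda$-calculus extended with a constant $C$; a $\lambda C$-term is $\beta$-normal if it contains no $\beta$-redex. Types: second-order formulas built from $\perp$ and atomic formulas $R(t_1,\dots,t_k)$ using $\rightarrow,\forall x,\forall X$; $\neg A=A\rightarrow\perp$; equations $u=v:=\forall Y(Y(u)\rightarrow Y(v))$, a fixed set of equations with $a\approx b$ meaning $a=b$ follows from it. $AF2$ typing rules for $\Gamma\vdash t:A$: axiom $\Gamma\vdash x_i:A_i$; $\rightarrow$-intro ($\lambda x t$) and elim (application); $\forall x$-intro ($x$ not free in $\Gamma$)/elim (any term); $\forall X$-intro ($X$ not free in $\Gamma$)/elim (any formula); equational rule (from $t:A[u/x]$, $u\approx v$ get $t:A[v/x]$). $M2$: there are in addition classical predicate variables $X_C$; a type ends with $X$ if it is $X(\vec t)$, or $A\rightarrow B$ with $B$ ending with $X$, or $\forall vA$ with $A$ ending with $X$; a classical type ends with $\perp$ or with a classical variable; $M2$ = $AF2$ rules plus $\Gamma\vdash C:\forall X_C\{\neg\neg X_C\rightarrow X_C\}$, $\forall X_C$-intro ($X_C$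 not free in $\Gamma$) and $\forall X_C$-elim instantiating only by classical types. Types of $AF2$ are those without classical variables. The sets $\Omega^+$ ($\forall$-positive) and $\Omega^-$ ($\forall$-negative) of $AF2$ types are the least sets such that: atomic types are in both; if $T\in\Omega^+$ and $T'\in\Omega^-$ then $T'\rightarrow T\in\Omega^+$ and $T\rightarrow T'\in\Omega^-$; if $T\in\Omega^+$ then $\forall xT\in\Omega^+$ and $\forall XT\in\Omega^+$; if $T\in\Omega^-$ then $\forall xT\in\Omega^-$, and $\forall XT\in\Omega^-$ provided $X$ has no free occurrence in $T$. *)

theory Defs
  imports Main
begin

text \<open>
  Binding is represented by de Bruijn indices throughout, so that alpha-equivalent terms and
  types are equal. A language is given by its function and relation symbols, each together with
  its arity.
\<close>

record ('f, 'p) language =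
  fun_syms :: "('f \<times> nat) set"
  rel_syms :: "('p \<times> nat) set"

datatype 'f trm = Var nat | Fun 'f "'f trm list"

primrec wf_trm :: "('f, 'p) language \<Rightarrow> 'f trm \<Rightarrow> bool" where
  "wf_trm L (Var i) \<longleftrightarrow> True"
| "wf_trm L (Fun f ts) \<longleftrightarrow> (f, length ts) \<in> fun_syms L \<and> list_all (wf_trm L) ts"

primrec tsubst :: "(nat \<Rightarrow> 'f trm) \<Rightarrow> 'f trm \<Rightarrow> 'f trm" where
  "tsubst \<sigma> (Var i) = \<sigma> i"
| "tsubst \<sigma> (Fun f ts) = Fun f (map (tsubst \<sigma>) ts)"

text \<open>
  The relation \<open>u \<approx> v\<close>: the equation \<open>u = v\<close> follows from the set \<open>E\<close> of equations, in equational
  logic over the language \<open>L\<close>. Individual variables in \<open>E\<close> are read as universally quantified.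
\<close>

inductive eqv :: "('f, 'p) language \<Rightarrow> ('f trm \<times> 'f trm) set \<Rightarrow> 'f trm \<Rightarrow> 'f trm \<Rightarrow> bool"
  for L E where
  eqv_ax: "(u, v) \<in> E \<Longrightarrow> (\<And>i. wf_trm L (\<sigma> i)) \<Longrightarrow> eqv L E (tsubst \<sigma> u) (tsubst \<sigma> v)"
| eqv_refl: "wf_trm L u \<Longrightarrow> eqv L E u u"
| eqv_sym: "eqv L E u v \<Longrightarrow> eqv L E v u"
| eqv_trans: "eqv L E u v \<Longrightarrow> eqv L E v w \<Longrightarrow> eqv L E u w"
| eqv_cong: "(f, length us) \<in> fun_syms L \<Longrightarrow> list_all2 (eqv L E) us vs
    \<Longrightarrow> eqv L E (Fun f us) (Fun f vs)"

text \<open>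
  There are countably many predicate variables of each kind and each arity, and every pair of a
  kind and an arity has an index space of its own: \<open>PVar \<kappa> i ts\<close> is an atom built from
  variable number \<open>i\<close> of kind \<open>\<kappa>\<close> and arity \<open>length ts\<close>, and \<open>AllP \<kappa> k A\<close> binds index \<open>0\<close> of
  kind \<open>\<kappa>\<close> and arity \<open>k\<close> in \<open>A\<close>. \<open>AllI\<close> binds an individual variable.
\<close>

datatype kind = Ordinary | Classical

datatype ('f, 'p) form =
    Bot
  | Rel 'p "'f trm list"
  | PVar kind nat "'f trm list"
  | Imp "('f, 'p) form" "('f, 'p) form"
  | AllI "('f, 'p) form"
  | AllP kind nat "('f, 'p) form"

abbreviation Neg :: "('f, 'p) form \<Rightarrow> ('f, 'p) form" where
  "Neg A \<equiv> Imp A Bot"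

primrec m2_type :: "('f, 'p) language \<Rightarrow> ('f, 'p) form \<Rightarrow> bool" where
  "m2_type L Bot \<longleftrightarrow> True"
| "m2_type L (Rel p ts) \<longleftrightarrow> (p, length ts) \<in> rel_syms L \<and> list_all (wf_trm L) ts"
| "m2_type L (PVar \<kappa> i ts) \<longleftrightarrow> list_all (wf_trm L) ts"
| "m2_type L (Imp A B) \<longleftrightarrow> m2_type L A \<and> m2_type L B"
| "m2_type L (AllI A) \<longleftrightarrow> m2_type L A"
| "m2_type L (AllP \<kappa> k A) \<longleftrightarrow> m2_type L A"

primrec no_classical_var :: "('f, 'p) form \<Rightarrow> bool" where
  "no_classical_var Bot \<longleftrightarrow> True"
| "no_classical_var (Rel p ts) \<longleftrightarrow> True"
| "no_classical_var (PVar \<kappa> i ts) \<longleftrightarrow> \<kappa> = Ordinary"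
| "no_classical_var (Imp A B) \<longleftrightarrow> no_classical_var A \<and> no_classical_var B"
| "no_classical_var (AllI A) \<longleftrightarrow> no_classical_var A"
| "no_classical_var (AllP \<kappa> k A) \<longleftrightarrow> \<kappa> = Ordinary \<and> no_classical_var A"

definition af2_type :: "('f, 'p) language \<Rightarrow> ('f, 'p) form \<Rightarrow> bool" where
  "af2_type L A \<longleftrightarrow> m2_type L A \<and> no_classical_var A"

primrec isubst :: "(nat \<Rightarrow> 'f trm) \<Rightarrow> ('f, 'p) form \<Rightarrow> ('f, 'p) form" where
  "isubst \<sigma> Bot = Bot"
| "isubst \<sigma> (Rel p ts) = Rel p (map (tsubst \<sigma>) ts)"
| "isubst \<sigma> (PVar \<kappa> i ts) = PVar \<kappa> i (map (tsubst \<sigma>) ts)"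
| "isubst \<sigma> (Imp A B) = Imp (isubst \<sigma> A) (isubst \<sigma> B)"
| "isubst \<sigma> (AllI A) = AllI (isubst (case_nat (Var 0) (\<lambda>i. tsubst (\<lambda>j. Var (Suc j)) (\<sigma> i))) A)"
| "isubst \<sigma> (AllP \<kappa> k A) = AllP \<kappa> k (isubst \<sigma> A)"

definition ilift :: "('f, 'p) form \<Rightarrow> ('f, 'p) form" where
  "ilift A = isubst (\<lambda>i. Var (Suc i)) A"

definition iinst :: "'f trm \<Rightarrow> ('f, 'p) form \<Rightarrow> ('f, 'p) form" where
  "iinst u A = isubst (case_nat u Var) A"

text \<open>
  \<open>plift \<kappa> k c A\<close> makes room for a fresh predicate variable of kind \<open>\<kappa>\<close> and arity \<open>k\<close> at index \<open>c\<close>.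
  \<open>psubst \<kappa> k c G A\<close> replaces every atom formed with the variable at index \<open>c\<close> and
  arguments \<open>ts\<close> by \<open>G[ts/x]\<close>, and removes this index. In \<open>G\<close> the individual indices below \<open>k\<close> are
  the parameters \<open>x\<close>; the other indices, reduced by \<open>k\<close>, are the free variables of \<open>G\<close>.
\<close>

primrec plift :: "kind \<Rightarrow> nat \<Rightarrow> nat \<Rightarrow> ('f, 'p) form \<Rightarrow> ('f, 'p) form" where
  "plift \<kappa> k c Bot = Bot"
| "plift \<kappa> k c (Rel p ts) = Rel p ts"
| "plift \<kappa> k c (PVar \<kappa>' i ts) =
     PVar \<kappa>' (if \<kappa>' = \<kappa> \<and> length ts = k \<and> c \<le> i then Suc i else i) ts"
| "plift \<kappa> k c (Imp A B) = Imp (plift \<kappa> k c A) (plift \<kappa> k c B)"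
| "plift \<kappa> k c (AllI A) = AllI (plift \<kappa> k c A)"
| "plift \<kappa> k c (AllP \<kappa>' k' A) =
     AllP \<kappa>' k' (plift \<kappa> k (if \<kappa>' = \<kappa> \<and> k' = k then Suc c else c) A)"

primrec psubst :: "kind \<Rightarrow> nat \<Rightarrow> nat \<Rightarrow> ('f, 'p) form \<Rightarrow> ('f, 'p) form \<Rightarrow> ('f, 'p) form" where
  "psubst \<kappa> k c G Bot = Bot"
| "psubst \<kappa> k c G (Rel p ts) = Rel p ts"
| "psubst \<kappa> k c G (PVar \<kappa>' i ts) =
     (if \<kappa>' = \<kappa> \<and> length ts = k
      then if i < c then PVar \<kappa>' i ts
           else if i = c then isubst (\<lambda>j. if j < k then ts ! j else Var (j - k)) G
           else PVar \<kappa>' (i - 1) ts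
      else PVar \<kappa>' i ts)"
| "psubst \<kappa> k c G (Imp A B) = Imp (psubst \<kappa> k c G A) (psubst \<kappa> k c G B)"
| "psubst \<kappa> k c G (AllI A) =
     AllI (psubst \<kappa> k c (isubst (\<lambda>j. Var (if j < k then j else Suc j)) G) A)"
| "psubst \<kappa> k c G (AllP \<kappa>' k' A) =
     AllP \<kappa>' k' (psubst \<kappa> k (if \<kappa>' = \<kappa> \<and> k' = k then Suc c else c) (plift \<kappa>' k' 0 G) A)"

primrec pfree :: "kind \<Rightarrow> nat \<Rightarrow> nat \<Rightarrow> ('f, 'p) form \<Rightarrow> bool" where
  "pfree \<kappa> k c Bot \<longleftrightarrow> False"
| "pfree \<kappa> k c (Rel p ts) \<longleftrightarrow> False"
| "pfree \<kappa> k c (PVar \<kappa>' i ts) \<longleftrightarrow> \<kappa>' = \<kappa> \<and> length ts = k \<and> i = c"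
| "pfree \<kappa> k c (Imp A B) \<longleftrightarrow> pfree \<kappa> k c A \<or> pfree \<kappa> k c B"
| "pfree \<kappa> k c (AllI A) \<longleftrightarrow> pfree \<kappa> k c A"
| "pfree \<kappa> k c (AllP \<kappa>' k' A) \<longleftrightarrow> pfree \<kappa> k (if \<kappa>' = \<kappa> \<and> k' = k then Suc c else c) A"

primrec ends_with_bot :: "('f, 'p) form \<Rightarrow> bool" where
  "ends_with_bot Bot \<longleftrightarrow> True"
| "ends_with_bot (Rel p ts) \<longleftrightarrow> False"
| "ends_with_bot (PVar \<kappa> i ts) \<longleftrightarrow> False"
| "ends_with_bot (Imp A B) \<longleftrightarrow> ends_with_bot B"
| "ends_with_bot (AllI A) \<longleftrightarrow> ends_with_bot A"
| "ends_with_bot (AllP \<kappa> k A) \<longleftrightarrow> ends_with_bot A"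

text \<open>
  The type ends with some classical variable. A quantifier is allowed to bind that
  variable: \<open>AllP Classical 0 (PVar Classical 0 [])\<close> ends with a classical variable.
\<close>

primrec ends_with_classical_var :: "('f, 'p) form \<Rightarrow> bool" where
  "ends_with_classical_var Bot \<longleftrightarrow> False"
| "ends_with_classical_var (Rel p ts) \<longleftrightarrow> False"
| "ends_with_classical_var (PVar \<kappa> i ts) \<longleftrightarrow> \<kappa> = Classical"
| "ends_with_classical_var (Imp A B) \<longleftrightarrow> ends_with_classical_var B"
| "ends_with_classical_var (AllI A) \<longleftrightarrow> ends_with_classical_var A"
| "ends_with_classical_var (AllP \<kappa> k A) \<longleftrightarrow> ends_with_classical_var A"

definition classical_type :: "('f, 'p) form \<Rightarrow> bool" where
  "classical_type A \<longleftrightarrow> ends_with_bot A \<or> ends_with_classical_var A"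

datatype lamC = LVar nat | Lam lamC | App lamC lamC | C

primrec C_free :: "lamC \<Rightarrow> bool" where
  "C_free (LVar i) \<longleftrightarrow> True"
| "C_free (Lam t) \<longleftrightarrow> C_free t"
| "C_free (App t u) \<longleftrightarrow> C_free t \<and> C_free u"
| "C_free C \<longleftrightarrow> False"

primrec beta_normal :: "lamC \<Rightarrow> bool" where
  "beta_normal (LVar i) \<longleftrightarrow> True"
| "beta_normal (Lam t) \<longleftrightarrow> beta_normal t"
| "beta_normal (App t u) \<longleftrightarrow> (\<forall>s. t \<noteq> Lam s) \<and> beta_normal t \<and> beta_normal u"
| "beta_normal C \<longleftrightarrow> True"

text \<open>
  In a context \<open>\<Gamma>\<close>, the type \<open>\<Gamma> ! i\<close> belongs to the variable \<open>LVar i\<close>. The proviso that a variable is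
  not free in the context is expressed by lifting the context in the premise. Since the leaves
  of a derivation require the context to consist of types of the system, all types that occur in
  a derivation are types of the system.
\<close>

inductive af2 ::
  "('f, 'p) language \<Rightarrow> ('f trm \<times> 'f trm) set \<Rightarrow> ('f, 'p) form list \<Rightarrow> lamC \<Rightarrow> ('f, 'p) form \<Rightarrow> bool"
  for L E where
  af2_var: "\<lbrakk>list_all (af2_type L) \<Gamma>; i < length \<Gamma>\<rbrakk> \<Longrightarrow> af2 L E \<Gamma> (LVar i) (\<Gamma> ! i)"
| af2_lam: "af2 L E (A # \<Gamma>) t B \<Longrightarrow> af2 L E \<Gamma> (Lam t) (Imp A B)"
| af2_app: "\<lbrakk>af2 L E \<Gamma> t (Imp A B); af2 L E \<Gamma> u A\<rbrakk> \<Longrightarrow> af2 L E \<Gamma> (App t u) B"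
| af2_allI_intro: "af2 L E (map ilift \<Gamma>) t A \<Longrightarrow> af2 L E \<Gamma> t (AllI A)"
| af2_allI_elim: "\<lbrakk>af2 L E \<Gamma> t (AllI A); wf_trm L u\<rbrakk> \<Longrightarrow> af2 L E \<Gamma> t (iinst u A)"
| af2_allP_intro: "af2 L E (map (plift Ordinary k 0) \<Gamma>) t A \<Longrightarrow> af2 L E \<Gamma> t (AllP Ordinary k A)"
| af2_allP_elim: "\<lbrakk>af2 L E \<Gamma> t (AllP Ordinary k A); af2_type L G\<rbrakk>
    \<Longrightarrow> af2 L E \<Gamma> t (psubst Ordinary k 0 G A)"
| af2_eq: "\<lbrakk>af2 L E \<Gamma> t (iinst u A); eqv L E u v\<rbrakk> \<Longrightarrow> af2 L E \<Gamma> t (iinst v A)"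

definition C_type :: "('f, 'p) form" where
  "C_type = AllP Classical 0
     (Imp (Neg (Neg (PVar Classical 0 []))) (PVar Classical 0 []))"

inductive m2 ::
  "('f, 'p) language \<Rightarrow> ('f trm \<times> 'f trm) set \<Rightarrow> ('f, 'p) form list \<Rightarrow> lamC \<Rightarrow> ('f, 'p) form \<Rightarrow> bool"
  for L E where
  m2_var: "\<lbrakk>list_all (m2_type L) \<Gamma>; i < length \<Gamma>\<rbrakk> \<Longrightarrow> m2 L E \<Gamma> (LVar i) (\<Gamma> ! i)"
| m2_lam: "m2 L E (A # \<Gamma>) t B \<Longrightarrow> m2 L E \<Gamma> (Lam t) (Imp A B)"
| m2_app: "\<lbrakk>m2 L E \<Gamma> t (Imp A B); m2 L E \<Gamma> u A\<rbrakk> \<Longrightarrow> m2 L E \<Gamma> (App t u) B"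
| m2_allI_intro: "m2 L E (map ilift \<Gamma>) t A \<Longrightarrow> m2 L E \<Gamma> t (AllI A)"
| m2_allI_elim: "\<lbrakk>m2 L E \<Gamma> t (AllI A); wf_trm L u\<rbrakk> \<Longrightarrow> m2 L E \<Gamma> t (iinst u A)"
| m2_allP_intro: "m2 L E (map (plift Ordinary k 0) \<Gamma>) t A \<Longrightarrow> m2 L E \<Gamma> t (AllP Ordinary k A)"
| m2_allP_elim: "\<lbrakk>m2 L E \<Gamma> t (AllP Ordinary k A); m2_type L G\<rbrakk>
    \<Longrightarrow> m2 L E \<Gamma> t (psubst Ordinary k 0 G A)"
| m2_eq: "\<lbrakk>m2 L E \<Gamma> t (iinst u A); eqv L E u v\<rbrakk> \<Longrightarrow> m2 L E \<Gamma> t (iinst v A)"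
| m2_C: "list_all (m2_type L) \<Gamma> \<Longrightarrow> m2 L E \<Gamma> C C_type"
| m2_allC_intro: "m2 L E (map (plift Classical k 0) \<Gamma>) t A \<Longrightarrow> m2 L E \<Gamma> t (AllP Classical k A)"
| m2_allC_elim: "\<lbrakk>m2 L E \<Gamma> t (AllP Classical k A); m2_type L G; classical_type G\<rbrakk>
    \<Longrightarrow> m2 L E \<Gamma> t (psubst Classical k 0 G A)"

text \<open>
  The atomic types are those of the form \<open>R(ts)\<close>, where \<open>R\<close> is a relation symbol or a predicate
  variable; \<open>Bot\<close> is not one of them.
\<close>

inductive all_positive :: "('f, 'p) form \<Rightarrow> bool" and all_negative :: "('f, 'p) form \<Rightarrow> bool" where
  pos_rel: "all_positive (Rel p ts)"
| pos_var: "all_positive (PVar Ordinary i ts)"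
| neg_rel: "all_negative (Rel p ts)"
| neg_var: "all_negative (PVar Ordinary i ts)"
| pos_imp: "\<lbrakk>all_negative A; all_positive B\<rbrakk> \<Longrightarrow> all_positive (Imp A B)"
| neg_imp: "\<lbrakk>all_positive A; all_negative B\<rbrakk> \<Longrightarrow> all_negative (Imp A B)"
| pos_allI: "all_positive A \<Longrightarrow> all_positive (AllI A)"
| pos_allP: "all_positive A \<Longrightarrow> all_positive (AllP Ordinary k A)"
| neg_allI: "all_negative A \<Longrightarrow> all_negative (AllI A)"
| neg_allP: "\<lbrakk>all_negative A; \<not> pfree Ordinary k 0 A\<rbrakk> \<Longrightarrow> all_negative (AllP Ordinary k A)"

end

theory Submission
  imports Defs
begin

text \<open>
  Erasing the classical quantifiers of a type and replacing its classical variables by \<open>Bot\<close> sends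
  classical types to types that end with \<open>Bot\<close>. As \<open>\<forall>\<close>-positive and \<open>\<forall>\<close>-negative types do not
  contain \<open>Bot\<close>, a type whose erasure is one of them has only vacuous classical quantifiers.

  A beta-normal term that is not an abstraction has a head, and the type of the term is inherited
  from the type of the head. If the head is \<open>C\<close> or has a classical type, the type stays classical
  under all the rules. If the head has a \<open>\<forall>\<close>-negative type, the type stays \<open>\<forall>\<close>-negative, because
  its free predicate variables are among those of the context: second-order quantifiers are then
  introduced and eliminated only vacuously. Hence the arguments of the head have
  \<open>\<forall>\<close>-positive types. As \<open>\<forall>\<close>-positivity passes from an instance \<open>A[G/X]\<close> to \<open>A\<close>, one induction on
  the derivation types all these terms in the system without classical variables.
\<close>

section \<open>Erasure of classical variables; types ending with \<open>Bot\<close>\<close>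

primrec erase :: "('f, 'p) form \<Rightarrow> ('f, 'p) form" where
  "erase Bot = Bot"
| "erase (Rel p ts) = Rel p ts"
| "erase (PVar \<kappa> i ts) = (if \<kappa> = Ordinary then PVar \<kappa> i ts else Bot)"
| "erase (Imp A B) = Imp (erase A) (erase B)"
| "erase (AllI A) = AllI (erase A)"
| "erase (AllP \<kappa> k A) = (if \<kappa> = Ordinary then AllP \<kappa> k (erase A) else erase A)"

lemma erase_id: "no_classical_var A \<Longrightarrow> erase A = A"
  by (induction A) auto

lemma af2_type_erase: "m2_type L A \<Longrightarrow> af2_type L (erase A)"
  unfolding af2_type_def by (induction A) auto

lemma classical_type_iff_erase: "classical_type A \<longleftrightarrow> ends_with_bot (erase A)"
  unfolding classical_type_def by (induction A) (auto intro: kind.exhaust)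

lemma erase_isubst: "erase (isubst \<sigma> A) = isubst \<sigma> (erase A)"
  by (induction A arbitrary: \<sigma>) auto

lemma erase_ilift: "erase (ilift A) = ilift (erase A)"
  by (simp add: ilift_def erase_isubst)

lemma erase_iinst: "erase (iinst u A) = iinst u (erase A)"
  by (simp add: iinst_def erase_isubst)

lemma erase_plift_ordinary: "erase (plift Ordinary k c A) = plift Ordinary k c (erase A)"
  by (induction A arbitrary: c) auto

text \<open>Classical variables have index spaces of their own, so moving their indices affects only
  atoms that erase to \<open>Bot\<close>.\<close>

lemma erase_plift_classical: "erase (plift Classical k c A) = erase A"
  by (induction A arbitrary: c) (auto split: if_splits)

lemma erase_psubst_ordinary:
  "erase (psubst Ordinary k c G A) = psubst Ordinary k c (erase G) (erase A)"
proof (induction A arbitrary: c G)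
  case (AllP \<kappa> k' A)
  then show ?case
    by (cases \<kappa>) (auto simp: erase_plift_ordinary erase_plift_classical)
qed (auto simp: erase_isubst)

lemma ends_with_bot_isubst [simp]: "ends_with_bot (isubst \<sigma> A) \<longleftrightarrow> ends_with_bot A"
  by (induction A arbitrary: \<sigma>) auto

lemma ends_with_bot_plift [simp]: "ends_with_bot (plift \<kappa> k c A) \<longleftrightarrow> ends_with_bot A"
  by (induction A arbitrary: c) auto

lemma ends_with_bot_erase_plift [simp]:
  "ends_with_bot (erase (plift \<kappa> k c A)) \<longleftrightarrow> ends_with_bot (erase A)"
  by (cases \<kappa>) (simp_all add: erase_plift_ordinary erase_plift_classical)

lemma ends_with_bot_psubst: "ends_with_bot A \<Longrightarrow> ends_with_bot (psubst \<kappa> k c G A)"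
  by (induction A arbitrary: c G) auto

text \<open>The final atom of \<open>A\<close> may be the replaced classical variable; the ending
  then comes from \<open>G\<close>.\<close>

lemma ends_with_bot_erase_psubst_classical:
  "\<lbrakk>ends_with_bot (erase G); ends_with_bot (erase A)\<rbrakk>
    \<Longrightarrow> ends_with_bot (erase (psubst Classical k c G A))"
  by (induction A arbitrary: c G) (auto simp: erase_isubst split: if_splits)

lemma ends_with_bot_ilift [simp]: "ends_with_bot (ilift A) \<longleftrightarrow> ends_with_bot A"
  by (simp add: ilift_def)

lemma ends_with_bot_iinst [simp]: "ends_with_bot (iinst u A) \<longleftrightarrow> ends_with_bot A"
  by (simp add: iinst_def)

section \<open>Free predicate variables\<close>

lemma pfree_isubst [simp]: "pfree \<kappa> k c (isubst \<sigma> A) \<longleftrightarrow> pfree \<kappa> k c A"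
  by (induction A arbitrary: c \<sigma>) auto

lemma pfree_ilift [simp]: "pfree \<kappa> k c (ilift A) \<longleftrightarrow> pfree \<kappa> k c A"
  by (simp add: ilift_def)

lemma pfree_iinst [simp]: "pfree \<kappa> k c (iinst u A) \<longleftrightarrow> pfree \<kappa> k c A"
  by (simp add: iinst_def)

lemma pfree_plift:
  "pfree \<kappa> k j (plift \<kappa>' k' c A) \<longleftrightarrow>
     (if \<kappa>' = \<kappa> \<and> k' = k \<and> c \<le> j then c < j \<and> pfree \<kappa> k (j - 1) A else pfree \<kappa> k j A)"
proof (induction A arbitrary: c j)
  case (AllP \<kappa>'' k'' A)
  show ?case
    unfolding plift.simps pfree.simps AllP.IH by (cases j) auto
qed auto

lemma pfree_psubst_vacuous:
  "\<not> pfree \<kappa> k c A \<Longrightarrow>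
     pfree \<kappa>' k' j (psubst \<kappa> k c G A) \<longleftrightarrow>
     pfree \<kappa>' k' (if \<kappa>' = \<kappa> \<and> k' = k \<and> c \<le> j then Suc j else j) A"
proof (induction A arbitrary: c j G)
  case (AllP \<kappa>'' k'' A)
  from AllP.prems show ?case
    by (auto simp: AllP.IH)
qed auto

text \<open>This carries the vacuity of an inner quantifier back from an instance to
  \<open>A\<close>.\<close>

lemma pfree_psubstI:
  "\<lbrakk>pfree \<kappa>' k' j A; \<not> (\<kappa>' = \<kappa> \<and> k' = k \<and> c \<le> j)\<rbrakk> \<Longrightarrow> pfree \<kappa>' k' j (psubst \<kappa> k c G A)"
  by (induction A arbitrary: c j G) auto

section \<open>Polarity under lifting and substitution\<close>

lemma all_positive_simps [simp]:
  "\<not> all_positive Bot"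
  "all_positive (Rel p ts)"
  "all_positive (PVar \<kappa> i ts) \<longleftrightarrow> \<kappa> = Ordinary"
  "all_positive (Imp A B) \<longleftrightarrow> all_negative A \<and> all_positive B"
  "all_positive (AllI A) \<longleftrightarrow> all_positive A"
  "all_positive (AllP \<kappa> k A) \<longleftrightarrow> \<kappa> = Ordinary \<and> all_positive A"
  by (auto elim: all_positive.cases intro: all_positive_all_negative.intros)

lemma all_negative_simps [simp]:
  "\<not> all_negative Bot"
  "all_negative (Rel p ts)"
  "all_negative (PVar \<kappa> i ts) \<longleftrightarrow> \<kappa> = Ordinary"
  "all_negative (Imp A B) \<longleftrightarrow> all_positive A \<and> all_negative B"
  "all_negative (AllI A) \<longleftrightarrow> all_negative A"
  "all_negative (AllP \<kappa> k A) \<longleftrightarrow> \<kappa> = Ordinary \<and> all_negative A \<and> \<not> pfree Ordinary k 0 A"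
  by (auto elim: all_negative.cases intro: all_positive_all_negative.intros)

text \<open>Both polarities share one induction because \<open>Imp\<close> swaps them on its
  left.\<close>

lemma all_polarity_isubst:
  "(all_positive (isubst \<sigma> A) \<longleftrightarrow> all_positive A) \<and> (all_negative (isubst \<sigma> A) \<longleftrightarrow> all_negative A)"
  by (induction A arbitrary: \<sigma>) auto

lemma all_polarity_iinst [simp]:
  "all_positive (iinst u A) \<longleftrightarrow> all_positive A"
  "all_negative (iinst u A) \<longleftrightarrow> all_negative A"
  by (simp_all add: iinst_def all_polarity_isubst)

lemma all_negative_ilift [simp]: "all_negative (ilift A) \<longleftrightarrow> all_negative A"
  by (simp add: ilift_def all_polarity_isubst)

lemma all_polarity_plift:
  "(all_positive (plift \<kappa> k c A) \<longleftrightarrow> all_positive A) \<and>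
   (all_negative (plift \<kappa> k c A) \<longleftrightarrow> all_negative A)"
  by (induction A arbitrary: c) (auto simp: pfree_plift)

text \<open>A replaced atom was an ordinary variable, which has both polarities whatever
  \<open>G\<close> is.\<close>

lemma all_polarity_psubst_ordinaryD:
  "(all_positive (psubst Ordinary k c G A) \<longrightarrow> all_positive A) \<and>
   (all_negative (psubst Ordinary k c G A) \<longrightarrow> all_negative A)"
proof (induction A arbitrary: c G)
  case (AllP \<kappa> k' A)
  then show ?case
    by (auto dest: pfree_psubstI)
qed (auto split: if_splits)

lemma all_polarity_psubst_vacuous:
  "\<not> pfree \<kappa> k c A \<Longrightarrow>
   (all_positive A \<longrightarrow> all_positive (psubst \<kappa> k c G A)) \<and>
   (all_negative A \<longrightarrow> all_negative (psubst \<kappa> k c G A))"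
  by (induction A arbitrary: c G) (auto simp: pfree_psubst_vacuous)

lemma ends_with_bot_no_polarity:
  "ends_with_bot A \<Longrightarrow> \<not> all_positive A \<and> \<not> all_negative A"
  by (induction A) auto

lemma erase_psubst_classical:
  "all_positive (erase A) \<or> all_negative (erase A) \<Longrightarrow> erase (psubst Classical k c G A) = erase A"
  by (induction A arbitrary: c G) (auto split: if_splits)

text \<open>A replaced atom would leave in the polarised instance a subformula whose erasure ends
  with \<open>Bot\<close>, and such a formula has no polarity.\<close>

lemma erase_psubst_classicalD:
  "\<lbrakk>ends_with_bot (erase G);
    all_positive (erase (psubst Classical k c G A)) \<or>
    all_negative (erase (psubst Classical k c G A))\<rbrakk>
    \<Longrightarrow> erase (psubst Classical k c G A) = erase A"
proof (induction A arbitrary: c G)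
  case (PVar \<kappa> i ts)
  then show ?case
    by (auto simp: erase_isubst all_polarity_isubst dest: ends_with_bot_no_polarity split: if_splits)
next
  case (AllP \<kappa> k' A)
  from AllP.prems show ?case
    by (cases "\<kappa> = Ordinary") (auto intro!: AllP.IH)
qed (auto simp: erase_isubst)

section \<open>Translation of derivations of normal terms\<close>

text \<open>The first part checks terms, abstractions included, against a positive type; the second
  follows the type of a head. The assumptions concern erasures because types inside a derivation may
  contain classical variables.\<close>

lemma m2_normal_af2:
  assumes "m2 L E (As @ Bs) t A"
    and "\<forall>A \<in> set As. all_negative (erase A)"
    and "\<forall>B \<in> set Bs. ends_with_bot (erase B)"
    and "beta_normal t"
  shows "(all_positive (erase A) \<longrightarrow> C_free t \<and> af2 L E (map erase As) t (erase A)) \<and>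
    ((\<forall>s. t \<noteq> Lam s) \<longrightarrow> ends_with_bot (erase A) \<or>
      (all_negative (erase A) \<and>
       (\<forall>k j. pfree Ordinary k j (erase A) \<longrightarrow> (\<exists>A' \<in> set As. pfree Ordinary k j (erase A'))) \<and>
       C_free t \<and> af2 L E (map erase As) t (erase A)))"
  using assms
proof (induction "As @ Bs" t A arbitrary: As Bs rule: m2.induct)
  case (m2_var i)
  have ctx: "list_all (af2_type L) (map erase As)"
    using m2_var.hyps(1) by (auto simp: list_all_iff af2_type_erase)
  show ?case
  proof (cases "i < length As")
    case True
    then have "af2 L E (map erase As) (LVar i) (map erase As ! i)"
      by (intro af2_var ctx) simp
    with True m2_var show ?thesis
      by (auto simp: nth_append)
  next
    case False
    then have "ends_with_bot (erase ((As @ Bs) ! i))"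
      using m2_var by (auto simp: nth_append)
    then show ?thesis
      using ends_with_bot_no_polarity by blast
  qed
next
  case (m2_lam A t B)
  \<comment> \<open>When the erasure of \<open>Imp A B\<close> is positive, that of \<open>A\<close>
    is negative, so the bound variable joins \<open>As\<close>.\<close>
  show ?case
    using m2_lam.hyps(2)[of "A # As" Bs] m2_lam.prems by (auto intro: af2_lam)
next
  case (m2_app t A B u)
  have t: "\<forall>s. t \<noteq> Lam s" "beta_normal t" and u: "beta_normal u"
    using m2_app.prems(3) by auto
  \<comment> \<open>Normality keeps \<open>t\<close> from being an abstraction, so the second part
    applies to \<open>t\<close>. A negative \<open>Imp\<close> has a positive domain, so the first
    part serves for \<open>u\<close>.\<close>
  have "ends_with_bot (erase B) \<or> all_negative (Imp (erase A) (erase B)) \<and>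
      (\<forall>k j. pfree Ordinary k j (Imp (erase A) (erase B)) \<longrightarrow>
        (\<exists>A' \<in> set As. pfree Ordinary k j (erase A'))) \<and>
      C_free t \<and> af2 L E (map erase As) t (Imp (erase A) (erase B))"
    using m2_app.hyps(2)[of As Bs] m2_app.prems(1,2) t by simp
  moreover have "all_positive (erase A) \<longrightarrow> C_free u \<and> af2 L E (map erase As) u (erase A)"
    using m2_app.hyps(4)[of As Bs] m2_app.prems(1,2) u by simp
  ultimately show ?case
    using ends_with_bot_no_polarity[of "erase B"] by (auto intro: af2_app)
next
  case (m2_allI_intro t A)
  have ctx: "map erase (map ilift As) = map ilift (map erase As)"
    by (simp add: erase_ilift)
  have "\<forall>B \<in> set (map ilift Bs). ends_with_bot (erase B)"
    using m2_allI_intro.prems by (simp add: erase_ilift)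
  then show ?case
    using m2_allI_intro.hyps(2)[of "map ilift As" "map ilift Bs"] m2_allI_intro.prems
    unfolding ctx by (auto simp: erase_ilift intro!: af2_allI_intro)
next
  case (m2_allI_elim t A u)
  then show ?case
    by (auto simp: erase_iinst intro: af2_allI_elim)
next
  case (m2_allP_intro k t A)
  have ctx: "map erase (map (plift Ordinary k 0) As) = map (plift Ordinary k 0) (map erase As)"
    by (simp add: erase_plift_ordinary)
  \<comment> \<open>Index \<open>0\<close> of arity \<open>k\<close> is not free in the lifted
    context, hence not in \<open>erase A\<close>: this is the vacuity that \<open>neg_allP\<close>
    demands.\<close>
  have free: "\<not> pfree Ordinary k 0 (erase A) \<and>
      (\<forall>k' j. pfree Ordinary k' j (erase (AllP Ordinary k A)) \<longrightarrow>
        (\<exists>A' \<in> set As. pfree Ordinary k' j (erase A')))"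
    if lifted: "\<forall>k' j. pfree Ordinary k' j (erase A) \<longrightarrow>
        (\<exists>A' \<in> set (map (plift Ordinary k 0) As). pfree Ordinary k' j (erase A'))"
  proof (intro conjI allI impI notI)
    assume "pfree Ordinary k 0 (erase A)"
    then have "\<exists>A' \<in> set (map (plift Ordinary k 0) As). pfree Ordinary k 0 (erase A')"
      using lifted by blast
    then show False
      by (auto simp: erase_plift_ordinary pfree_plift)
  next
    fix k' j
    assume "pfree Ordinary k' j (erase (AllP Ordinary k A))"
    then have "pfree Ordinary k' (if k = k' then Suc j else j) (erase A)"
      by simp
    then have "\<exists>A' \<in> set (map (plift Ordinary k 0) As).
        pfree Ordinary k' (if k = k' then Suc j else j) (erase A')"
      using lifted by blast
    then show "\<exists>A' \<in> set As. pfree Ordinary k' j (erase A')"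
      by (auto simp: erase_plift_ordinary pfree_plift split: if_splits)
  qed
  have "\<forall>A \<in> set (map (plift Ordinary k 0) As). all_negative (erase A)"
    and "\<forall>B \<in> set (map (plift Ordinary k 0) Bs). ends_with_bot (erase B)"
    using m2_allP_intro.prems by (simp_all add: erase_plift_ordinary all_polarity_plift)
  note IH = m2_allP_intro.hyps(2)[OF map_append this m2_allP_intro.prems(3), unfolded ctx]
  have intro: "af2 L E (map erase As) t (erase (AllP Ordinary k A))"
    if "af2 L E (map (plift Ordinary k 0) (map erase As)) t (erase A)"
    using af2_allP_intro[OF that] by simp
  show ?case
    using IH free intro by auto
next
  case (m2_allP_elim t k A G)
  have elim: "af2 L E (map erase As) t (erase (psubst Ordinary k 0 G A))"
    if "af2 L E (map erase As) t (AllP Ordinary k (erase A))"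
    using af2_allP_elim[OF that af2_type_erase] m2_allP_elim.hyps
    by (simp add: erase_psubst_ordinary)
  note IH = m2_allP_elim.hyps(2)[OF refl m2_allP_elim.prems]
  show ?case
  proof (intro conjI impI)
    assume "all_positive (erase (psubst Ordinary k 0 G A))"
    then have "all_positive (erase A)"
      using all_polarity_psubst_ordinaryD by (auto simp: erase_psubst_ordinary)
    then show "C_free t" "af2 L E (map erase As) t (erase (psubst Ordinary k 0 G A))"
      using IH elim by simp_all
  next
    assume "\<forall>s. t \<noteq> Lam s"
    with IH consider (bot) "ends_with_bot (erase A)"
      | (neg) "all_negative (erase A)" "\<not> pfree Ordinary k 0 (erase A)"
        "\<forall>k' j. pfree Ordinary k' j (AllP Ordinary k (erase A)) \<longrightarrow>
          (\<exists>A' \<in> set As. pfree Ordinary k' j (erase A'))"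
        "C_free t" "af2 L E (map erase As) t (AllP Ordinary k (erase A))"
      by auto
    then show "ends_with_bot (erase (psubst Ordinary k 0 G A)) \<or>
        all_negative (erase (psubst Ordinary k 0 G A)) \<and>
        (\<forall>k' j. pfree Ordinary k' j (erase (psubst Ordinary k 0 G A)) \<longrightarrow>
          (\<exists>A' \<in> set As. pfree Ordinary k' j (erase A'))) \<and>
        C_free t \<and> af2 L E (map erase As) t (erase (psubst Ordinary k 0 G A))"
    proof cases
      case bot
      then show ?thesis
        by (simp add: erase_psubst_ordinary ends_with_bot_psubst)
    next
      case neg
      \<comment> \<open>As index \<open>0\<close> does not occur, instantiating and binding it shift
        the other indices alike.\<close>
      from neg(3) have "\<forall>k' j. pfree Ordinary k' j (erase (psubst Ordinary k 0 G A)) \<longrightarrow>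
          (\<exists>A' \<in> set As. pfree Ordinary k' j (erase A'))"
        by (simp add: erase_psubst_ordinary pfree_psubst_vacuous[OF neg(2)] eq_commute[of k])
      moreover have "all_negative (erase (psubst Ordinary k 0 G A))"
        using neg(1,2) by (simp add: erase_psubst_ordinary all_polarity_psubst_vacuous)
      ultimately show ?thesis
        using neg(4) elim[OF neg(5)] by blast
    qed
  qed
next
  case (m2_eq t u A v)
  then show ?case
    by (auto simp: erase_iinst intro: af2_eq)
next
  case m2_C
  \<comment> \<open>\<open>C_type\<close> erases to \<open>Imp (Neg (Neg Bot)) Bot\<close>, which
    ends with \<open>Bot\<close> and is not positive.\<close>
  show ?case
    by (simp add: C_type_def)
next
  case (m2_allC_intro k t A)
  show ?case
    using m2_allC_intro.hyps(2)[of "map (plift Classical k 0) As" "map (plift Classical k 0) Bs"]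
      m2_allC_intro.prems
    by (auto simp: erase_plift_classical comp_def)
next
  case (m2_allC_elim t k A G)
  have G: "ends_with_bot (erase G)"
    using m2_allC_elim.hyps by (simp add: classical_type_iff_erase)
  note IH = m2_allC_elim.hyps(2)[OF refl m2_allC_elim.prems]
  \<comment> \<open>A polarised erasure of \<open>A\<close> is unchanged by the instantiation.
    Otherwise the instance is not positive, and for a non-abstraction the erasure of
    \<open>A\<close> ends with \<open>Bot\<close>, which the classical \<open>G\<close>
    preserves.\<close>
  show ?case
  proof (cases "all_positive (erase A) \<or> all_negative (erase A)")
    case True
    then have "erase (psubst Classical k 0 G A) = erase (AllP Classical k A)"
      by (simp add: erase_psubst_classical)
    with IH show ?thesis
      by simp
  next
    case False
    then have "\<not> all_positive (erase (psubst Classical k 0 G A))"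
      using erase_psubst_classicalD[OF G] by metis
    moreover have "(\<forall>s. t \<noteq> Lam s) \<longrightarrow> ends_with_bot (erase A)"
      using IH False by simp
    ultimately show ?thesis
      using ends_with_bot_erase_psubst_classical[OF G] by simp
  qed
qed

theorem theorem4p1:
  fixes L :: "('f, 'p) language"
    and E :: "('f trm \<times> 'f trm) set"
    and As Bs :: "('f, 'p) form list"
    and A :: "('f, 'p) form"
    and t :: lamC
  assumes "\<forall>(u, v) \<in> E. wf_trm L u \<and> wf_trm L v"
    and "\<forall>A' \<in> set As. af2_type L A' \<and> all_negative A'"
    and "af2_type L A" and "all_positive A" and "\<not> ends_with_bot A"
    and "\<forall>B \<in> set Bs. m2_type L B \<and> classical_type B"
    and "beta_normal t"
    and "m2 L E (As @ Bs) t A"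
  shows "C_free t \<and> beta_normal t \<and> af2 L E As t A"
proof -
  \<comment> \<open>Types of AF2 are fixed by erasure, so the erased derivation has the given
    context and type.\<close>
  have erase_As: "erase A' = A'" if "A' \<in> set As" for A'
    using that assms(2) by (auto simp: af2_type_def erase_id)
  then have map_As: "map erase As = As"
    by (simp add: map_idI)
  have erase_A: "erase A = A"
    using assms(3) by (auto simp: af2_type_def erase_id)
  have "\<forall>A' \<in> set As. all_negative (erase A')"
    using assms(2) erase_As by auto
  moreover have "\<forall>B \<in> set Bs. ends_with_bot (erase B)"
    using assms(6) by (auto simp: classical_type_iff_erase)
  ultimately show ?thesis
    using m2_normal_af2[OF assms(8)] assms(4,7) by (simp add: map_As erase_A)
qed

end
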